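(* Assume the Continuum Hypothesis. Then there exist continuous homomorphisms of topological groups $f:A\to M$ and $g:M\to N$ such that $f$ is proper and $g$ is c-complete, but the composite $g\cdot f:A\to N$ is not h-complete.
   Context: Topological groups are not assumed to be Hausdorff unless stated. A continuous homomorphism is (topologically) proper if it is a closed map with compact fibres. A continuous homomorphism $f:G\to H$ is c-closed if $f(A)$ is closed in $H$ for every closed subgroup $A\le G$. A continuous homomorphism $k:K\to H$ is (fibrewise) Hausdorff if any two distinct points of the same fibre of $k$ can be separated by disjoint open neighbourhoods in $K$. A continuous homomorphism $f:G\to H$ is h-complete (respectively c-complete) if for every topological group $K$ and every factorization $f=k\cdot h$ into continuous homomorphisms $h:G\to K$, $k:K\to H$ with $k$ Hausdorff, the image $h(G)$ is closed in $K$ (respectively, $h$ is c-closed). *)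

theory Defs
  imports
    "HOL-Analysis.Analysis"
    "HOL-Algebra.Group"
    "HOL-Library.Equipollence"
begin

definition continuum_hypothesis :: bool
  where "continuum_hypothesis \<longleftrightarrow>
    (\<forall>S :: real set. uncountable S \<longrightarrow> S \<approx> (UNIV :: real set))"

record 'a tgroup = "'a monoid" +
  topol :: "'a topology"

text \<open>No separation axiom is imposed on topological groups.\<close>

definition topological_group :: "'a tgroup \<Rightarrow> bool"
  where "topological_group G \<longleftrightarrow>
    group G \<and> topspace (topol G) = carrier G \<and>
    continuous_map (prod_topology (topol G) (topol G)) (topol G) (\<lambda>(x, y). x \<otimes>\<^bsub>G\<^esub> y) \<and>
    continuous_map (topol G) (topol G) (m_inv G)"

definition continuous_hom :: "'a tgroup \<Rightarrow> 'b tgroup \<Rightarrow> ('a \<Rightarrow> 'b) \<Rightarrow> bool"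
  where "continuous_hom G H f \<longleftrightarrow> f \<in> hom G H \<and> continuous_map (topol G) (topol H) f"

definition c_closed :: "'a tgroup \<Rightarrow> 'b tgroup \<Rightarrow> ('a \<Rightarrow> 'b) \<Rightarrow> bool"
  where "c_closed G H f \<longleftrightarrow>
    (\<forall>A. subgroup A G \<and> closedin (topol G) A \<longrightarrow> closedin (topol H) (f ` A))"

definition fibrewise_Hausdorff :: "'a tgroup \<Rightarrow> ('a \<Rightarrow> 'b) \<Rightarrow> bool"
  where "fibrewise_Hausdorff K k \<longleftrightarrow>
    (\<forall>x \<in> carrier K. \<forall>y \<in> carrier K. x \<noteq> y \<and> k x = k y \<longrightarrow>
      (\<exists>U V. openin (topol K) U \<and> openin (topol K) V \<and> x \<in> U \<and> y \<in> V \<and> disjnt U V))"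

definition Hausdorff_factorization ::
  "'a tgroup \<Rightarrow> 'b tgroup \<Rightarrow> ('a \<Rightarrow> 'b) \<Rightarrow> 'c tgroup \<Rightarrow> ('a \<Rightarrow> 'c) \<Rightarrow> ('c \<Rightarrow> 'b) \<Rightarrow> bool"
  where "Hausdorff_factorization G H f K h k \<longleftrightarrow>
    topological_group K \<and> continuous_hom G K h \<and> continuous_hom K H k \<and>
    fibrewise_Hausdorff K k \<and> (\<forall>x \<in> carrier G. f x = k (h x))"

text \<open>
  A definition in HOL cannot quantify over the type of the elements of the intermediate
  group \<open>K\<close>, so \<open>K\<close> is taken with elements in \<^typ>\<open>'a set set \<times> 'b\<close>. This is no
  restriction: a point \<open>x\<close> of the closure of \<open>h(G)\<close> in \<open>K\<close> is determined by \<open>k x\<close> and by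
  the family of the preimages under \<open>h\<close> of its open neighbourhoods. The theorems
  \<open>h_complete_universal\<close> and \<open>c_complete_universal\<close> below recover the defining property
  for groups \<open>K\<close> over an arbitrary type.
\<close>

definition h_complete :: "'a tgroup \<Rightarrow> 'b tgroup \<Rightarrow> ('a \<Rightarrow> 'b) \<Rightarrow> bool"
  where "h_complete G H f \<longleftrightarrow>
    (\<forall>(K :: ('a set set \<times> 'b) tgroup) h k.
      Hausdorff_factorization G H f K h k \<longrightarrow> closedin (topol K) (h ` carrier G))"

definition c_complete :: "'a tgroup \<Rightarrow> 'b tgroup \<Rightarrow> ('a \<Rightarrow> 'b) \<Rightarrow> bool"
  where "c_complete G H f \<longleftrightarrow>
    (\<forall>(K :: ('a set set \<times> 'b) tgroup) h k.
      Hausdorff_factorization G H f K h k \<longrightarrow> c_closed G K h)"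

lemma subgroup_closure_of:
  assumes K: "topological_group K" and A: "subgroup A K"
  shows "subgroup (topol K closure_of A) K"
proof -
  let ?T = "topol K" let ?C = "?T closure_of A"
  interpret group K using K by (simp add: topological_group_def)
  have ts: "topspace ?T = carrier K"
    and m: "continuous_map (prod_topology ?T ?T) ?T (\<lambda>(x, y). x \<otimes>\<^bsub>K\<^esub> y)"
    and i: "continuous_map ?T ?T (m_inv K)"
    using K by (auto simp: topological_group_def)
  have AC: "A \<subseteq> ?C"
    using A ts by (simp add: closure_of_subset subgroup.subset)
  have mC: "x \<otimes>\<^bsub>K\<^esub> y \<in> ?C" if "x \<in> ?C" "y \<in> ?C" for x y
  proof -
    have "(\<lambda>(x, y). x \<otimes>\<^bsub>K\<^esub> y) ` (prod_topology ?T ?T closure_of (A \<times> A))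
        \<subseteq> ?T closure_of ((\<lambda>(x, y). x \<otimes>\<^bsub>K\<^esub> y) ` (A \<times> A))"
      by (rule continuous_map_image_closure_subset[OF m])
    also have "\<dots> \<subseteq> ?C"
      by (rule closure_of_mono) (use A in \<open>auto simp: subgroup.m_closed\<close>)
    finally show ?thesis using that by (auto simp: closure_of_Times)
  qed
  have iC: "inv\<^bsub>K\<^esub> x \<in> ?C" if "x \<in> ?C" for x
  proof -
    have "m_inv K ` ?C \<subseteq> ?T closure_of (m_inv K ` A)"
      by (rule continuous_map_image_closure_subset[OF i])
    also have "\<dots> \<subseteq> ?C"
      by (rule closure_of_mono) (use A in \<open>auto simp: subgroup.m_inv_closed\<close>)
    finally show ?thesis using that by auto
  qed
  show ?thesis
    by (rule subgroupI)
      (use AC A mC iC ts closure_of_subset_topspace[of ?T A] in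
        \<open>auto dest: subgroup.one_closed\<close>)
qed

lemma transport_subgroup:
  fixes K :: "'c tgroup" and \<phi> :: "'c \<Rightarrow> 'd"
  assumes K: "topological_group K" and C: "subgroup C K" and inj: "inj_on \<phi> C"
  obtains K' :: "'d tgroup" and \<psi> :: "'d \<Rightarrow> 'c"
  where "topological_group K'" "carrier K' = \<phi> ` C" "\<And>x. x \<in> C \<Longrightarrow> \<psi> (\<phi> x) = x"
    "\<And>x y. x \<in> C \<Longrightarrow> y \<in> C \<Longrightarrow> \<phi> x \<otimes>\<^bsub>K'\<^esub> \<phi> y = \<phi> (x \<otimes>\<^bsub>K\<^esub> y)"
    "\<And>S. openin (topol K') S \<longleftrightarrow> (\<exists>U. openin (topol K) U \<and> S = \<phi> ` (C \<inter> U))"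
proof -
  define \<psi> where "\<psi> = inv_into C \<phi>"
  have \<psi>: "\<psi> (\<phi> x) = x" if "x \<in> C" for x using inj that by (simp add: \<psi>_def)
  define T where "T = pullback_topology (\<phi> ` C) \<psi> (topol K)"
  define K' :: "'d tgroup" where
    "K' = \<lparr>carrier = \<phi> ` C, mult = (\<lambda>a b. \<phi> (\<psi> a \<otimes>\<^bsub>K\<^esub> \<psi> b)), one = \<phi> \<one>\<^bsub>K\<^esub>, topol = T\<rparr>"
  interpret K: group K using K by (simp add: topological_group_def)
  interpret C: subgroup C K by (rule C)
  have ts: "topspace (topol K) = carrier K"
    and m: "continuous_map (prod_topology (topol K) (topol K)) (topol K) (\<lambda>(x, y). x \<otimes>\<^bsub>K\<^esub> y)"
    and i: "continuous_map (topol K) (topol K) (m_inv K)"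
    using K by (auto simp: topological_group_def)
  have mult: "\<phi> x \<otimes>\<^bsub>K'\<^esub> \<phi> y = \<phi> (x \<otimes>\<^bsub>K\<^esub> y)" if "x \<in> C" "y \<in> C" for x y
    using that by (simp add: K'_def \<psi>)
  have grp: "group K'"
  proof (rule groupI)
    fix a assume "a \<in> carrier K'"
    then obtain x where x: "x \<in> C" "a = \<phi> x" by (auto simp: K'_def)
    have "\<phi> (inv\<^bsub>K\<^esub> x) \<otimes>\<^bsub>K'\<^esub> a = \<phi> (inv\<^bsub>K\<^esub> x \<otimes>\<^bsub>K\<^esub> x)"
      using x by (simp add: mult)
    also have "\<dots> = \<one>\<^bsub>K'\<^esub>" using x by (simp add: K'_def)
    finally show "\<exists>b \<in> carrier K'. b \<otimes>\<^bsub>K'\<^esub> a = \<one>\<^bsub>K'\<^esub>"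
      using x by (auto simp: K'_def)
  qed (auto simp: K'_def \<psi> K.m_assoc)
  have inv': "inv\<^bsub>K'\<^esub> (\<phi> x) = \<phi> (inv\<^bsub>K\<^esub> x)" if x: "x \<in> C" for x
  proof (rule group.inv_equality[OF grp])
    show "\<phi> (inv\<^bsub>K\<^esub> x) \<otimes>\<^bsub>K'\<^esub> \<phi> x = \<one>\<^bsub>K'\<^esub>"
      using x by (simp add: mult) (simp add: K'_def)
  qed (use x in \<open>auto simp: K'_def\<close>)
  have tT: "topspace T = \<phi> ` C"
    using C.subset by (auto simp: T_def topspace_pullback_topology ts \<psi>)
  have "continuous_map T (topol K) (id \<circ> \<psi>)"
    unfolding T_def by (rule continuous_map_pullback) simp
  then have c\<psi>: "continuous_map T (topol K) \<psi>" by simp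
  have "continuous_map (prod_topology T T) (topol K) (\<lambda>p. \<psi> (fst p) \<otimes>\<^bsub>K\<^esub> \<psi> (snd p))"
  proof -
    have "continuous_map (prod_topology T T) (prod_topology (topol K) (topol K))
        (\<lambda>p. (\<psi> (fst p), \<psi> (snd p)))"
      by (intro continuous_map_pairedI continuous_map_compose[OF continuous_map_fst c\<psi>, unfolded o_def]
          continuous_map_compose[OF continuous_map_snd c\<psi>, unfolded o_def])
    from continuous_map_compose[OF this m] show ?thesis by (simp add: o_def)
  qed
  then have cm: "continuous_map (prod_topology T T) T (\<lambda>(a, b). a \<otimes>\<^bsub>K'\<^esub> b)"
    unfolding T_def
    by (intro continuous_map_pullback')
      (use tT in \<open>auto simp: T_def K'_def \<psi> o_def case_prod_unfold elim!: continuous_map_eq\<close>)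
  have "continuous_map T (topol K) (\<lambda>a. inv\<^bsub>K\<^esub> (\<psi> a))"
    using continuous_map_compose[OF c\<psi> i] by (simp add: o_def)
  then have "continuous_map T (topol K) (\<psi> \<circ> (m_inv K'))"
    by (rule continuous_map_eq) (auto simp: tT inv' \<psi>)
  then have ci: "continuous_map T T (m_inv K')"
    using tT inv' unfolding T_def by (intro continuous_map_pullback') auto
  have op: "openin T S \<longleftrightarrow> (\<exists>U. openin (topol K) U \<and> S = \<phi> ` (C \<inter> U))" for S
  proof -
    have "\<psi> -` U \<inter> \<phi> ` C = \<phi> ` (C \<inter> U)" for U by (auto simp: \<psi>)
    then show ?thesis by (simp add: T_def openin_pullback_topology)
  qed
  show thesis
  proof (rule that[of K' \<psi>])
    show "topological_group K'"
      using grp tT cm ci by (simp add: topological_group_def) (simp add: K'_def)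
    show "carrier K' = \<phi> ` C" by (simp add: K'_def)
    show "openin (topol K') S \<longleftrightarrow> (\<exists>U. openin (topol K) U \<and> S = \<phi> ` (C \<inter> U))" for S
      using op by (simp add: K'_def)
  qed (fact \<psi> mult)+
qed

lemma small_Hausdorff_factorization:
  fixes G :: "'a tgroup" and H :: "'b tgroup" and K :: "'c tgroup"
  assumes G: "topological_group G" and F: "Hausdorff_factorization G H f K h k"
  obtains K' :: "('a set set \<times> 'b) tgroup" and h' k'
  where "Hausdorff_factorization G H f K' h' k'"
    "\<And>B. B \<subseteq> carrier G \<Longrightarrow> closedin (topol K') (h' ` B) \<Longrightarrow> closedin (topol K) (h ` B)"
proof -
  have K: "topological_group K" and hh: "h \<in> hom G K" and hc: "continuous_map (topol G) (topol K) h"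
    and kh: "k \<in> hom K H" and kc: "continuous_map (topol K) (topol H) k"
    and haus: "fibrewise_Hausdorff K k" and fkh: "\<And>x. x \<in> carrier G \<Longrightarrow> f x = k (h x)"
    using F by (auto simp: Hausdorff_factorization_def continuous_hom_def)
  interpret G: group G using G by (simp add: topological_group_def)
  interpret K: group K using K by (simp add: topological_group_def)
  interpret h: group_hom G K h using hh by unfold_locales
  have tsG: "topspace (topol G) = carrier G" and ts: "topspace (topol K) = carrier K"
    using G K by (auto simp: topological_group_def)
  define C where "C = topol K closure_of (h ` carrier G)"
  have C: "subgroup C K"
    unfolding C_def by (intro subgroup_closure_of K h.img_is_subgroup)
  have CK: "C \<subseteq> carrier K" using C by (rule subgroup.subset)
  have "h ` carrier G \<subseteq> C"
    unfolding C_def by (rule closure_of_subset) (auto simp: ts)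
  then have hC: "h x \<in> C" if "x \<in> carrier G" for x
    using that by blast
  define \<phi> where
    "\<phi> x = ({h -` U \<inter> carrier G |U. openin (topol K) U \<and> x \<in> U}, k x)" for x
  have inj: "inj_on \<phi> C"
  proof (rule inj_onI, rule ccontr)
    fix x y assume xy: "x \<in> C" "y \<in> C" "\<phi> x = \<phi> y" "x \<noteq> y"
    then have "k x = k y" by (simp add: \<phi>_def)
    with xy haus CK obtain U V where UV: "openin (topol K) U" "openin (topol K) V"
        "x \<in> U" "y \<in> V" "disjnt U V"
      unfolding fibrewise_Hausdorff_def by (meson subsetD)
    then have "h -` U \<inter> carrier G \<in> fst (\<phi> x)" by (auto simp: \<phi>_def)
    then have "h -` U \<inter> carrier G \<in> fst (\<phi> y)" using xy by simp
    then obtain W where W: "openin (topol K) W" "y \<in> W"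
        "h -` U \<inter> carrier G = h -` W \<inter> carrier G"
      by (auto simp: \<phi>_def)
    have "openin (topol K) (V \<inter> W)" "y \<in> V \<inter> W" using UV W by auto
    then obtain g where "g \<in> carrier G" "h g \<in> V \<inter> W"
      using xy(2) unfolding C_def in_closure_of by blast
    then show False using W(3) UV(5) by (auto simp: disjnt_def)
  qed
  obtain K' and \<psi> where K': "topological_group K'" and cK': "carrier K' = \<phi> ` C"
    and \<psi>: "\<And>x. x \<in> C \<Longrightarrow> \<psi> (\<phi> x) = x"
    and mult: "\<And>x y. x \<in> C \<Longrightarrow> y \<in> C \<Longrightarrow> \<phi> x \<otimes>\<^bsub>K'\<^esub> \<phi> y = \<phi> (x \<otimes>\<^bsub>K\<^esub> y)"
    and op: "\<And>S. openin (topol K') S \<longleftrightarrow> (\<exists>U. openin (topol K) U \<and> S = \<phi> ` (C \<inter> U))"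
    using transport_subgroup[OF K C inj] by metis
  have ts': "topspace (topol K') = \<phi> ` C" using K' cK' by (simp add: topological_group_def)
  have snd: "snd (\<phi> x) = k x" for x by (simp add: \<phi>_def)
  show thesis
  proof (rule that[of K' "\<phi> \<circ> h" snd])
    have "\<phi> \<circ> h \<in> hom G K'"
      using hC by (intro homI) (auto simp: cK' mult)
    moreover have "continuous_map (topol G) (topol K') (\<phi> \<circ> h)"
      unfolding continuous_map_def
    proof (intro conjI allI impI)
      show "\<phi> \<circ> h \<in> topspace (topol G) \<rightarrow> topspace (topol K')"
        using hC by (auto simp: tsG ts')
      fix S assume "openin (topol K') S"
      then obtain U where U: "openin (topol K) U" "S = \<phi> ` (C \<inter> U)" by (auto simp: op)
      have "{x \<in> topspace (topol G). (\<phi> \<circ> h) x \<in> S} = {x \<in> topspace (topol G). h x \<in> U}"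
        using hC inj by (auto simp: U(2) tsG inj_on_def)
      also have "openin (topol G) \<dots>"
        using hc U(1) by (simp add: continuous_map_def)
      finally show "openin (topol G) {x \<in> topspace (topol G). (\<phi> \<circ> h) x \<in> S}" .
    qed
    moreover have "snd \<in> hom K' H"
      using kh CK by (intro homI) (auto simp: cK' mult snd hom_def Pi_iff subset_iff)
    moreover have "continuous_map (topol K') (topol H) snd"
      unfolding continuous_map_def
    proof (intro conjI allI impI)
      show "snd \<in> topspace (topol K') \<rightarrow> topspace (topol H)"
        using kc CK by (auto simp: ts' snd continuous_map_def ts)
      fix V assume "openin (topol H) V"
      then have "openin (topol K) {x \<in> topspace (topol K). k x \<in> V}"
        using kc by (simp add: continuous_map_def)
      moreover have "{a \<in> topspace (topol K'). snd a \<in> V}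
          = \<phi> ` (C \<inter> {x \<in> topspace (topol K). k x \<in> V})"
        using CK by (auto simp: ts' ts snd)
      ultimately show "openin (topol K') {a \<in> topspace (topol K'). snd a \<in> V}"
        by (auto simp: op)
    qed
    moreover have "fibrewise_Hausdorff K' snd"
      unfolding fibrewise_Hausdorff_def cK'
    proof (intro ballI impI)
      fix a b assume "a \<in> \<phi> ` C" "b \<in> \<phi> ` C" and ab: "a \<noteq> b \<and> snd a = snd b"
      then obtain x y where xy: "x \<in> C" "y \<in> C" "a = \<phi> x" "b = \<phi> y" by auto
      then have "x \<in> carrier K" "y \<in> carrier K" "x \<noteq> y \<and> k x = k y"
        using ab CK by (auto simp: snd)
      with haus obtain U V where UV: "openin (topol K) U" "openin (topol K) V"
          "x \<in> U" "y \<in> V" "disjnt U V"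
        unfolding fibrewise_Hausdorff_def by blast
      have "disjnt (\<phi> ` (C \<inter> U)) (\<phi> ` (C \<inter> V))"
        using UV(5) inj unfolding disjnt_def inj_on_def by blast
      then show "\<exists>U V. openin (topol K') U \<and> openin (topol K') V \<and> a \<in> U \<and> b \<in> V \<and> disjnt U V"
        using UV xy by (intro exI[of _ "\<phi> ` (C \<inter> U)"] exI[of _ "\<phi> ` (C \<inter> V)"])
          (auto simp: op)
    qed
    ultimately show "Hausdorff_factorization G H f K' (\<phi> \<circ> h) snd"
      using K' fkh by (simp add: Hausdorff_factorization_def continuous_hom_def snd)
  next
    fix B assume B: "B \<subseteq> carrier G" and cl: "closedin (topol K') ((\<phi> \<circ> h) ` B)"
    have hB: "h ` B \<subseteq> C" using B hC by auto
    from cl obtain U where U: "openin (topol K) U" "\<phi> ` C - (\<phi> \<circ> h) ` B = \<phi> ` (C \<inter> U)"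
      by (auto simp: closedin_def ts' op)
    have "\<phi> ` (C - h ` B) = \<phi> ` (C \<inter> U)"
      using U(2) inj_on_image_set_diff[OF inj, of C "h ` B"] hB by (simp add: image_comp)
    then have "C - h ` B = C \<inter> U"
      using inj by (meson Diff_subset inf_le1 inj_on_image_eq_iff)
    then have "h ` B = C \<inter> (topspace (topol K) - U)"
      using hB CK ts by auto
    moreover have "closedin (topol K) \<dots>"
      unfolding C_def by (intro closedin_Int closedin_closure_of closedin_diff) (use U in auto)
    ultimately show "closedin (topol K) (h ` B)" by simp
  qed
qed

theorem h_complete_universal:
  fixes K :: "'c tgroup"
  assumes "topological_group G" "h_complete G H f" "Hausdorff_factorization G H f K h k"
  shows "closedin (topol K) (h ` carrier G)"
  using small_Hausdorff_factorization[OF assms(1,3)] assms(2)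
  unfolding h_complete_def by (metis order_refl)

theorem c_complete_universal:
  fixes K :: "'c tgroup"
  assumes "topological_group G" "c_complete G H f" "Hausdorff_factorization G H f K h k"
  shows "c_closed G K h"
  using small_Hausdorff_factorization[OF assms(1,3)] assms(2)
  unfolding c_complete_def c_closed_def by (metis subgroup.subset)

end

theory Submission
  imports Defs "HOL-Analysis.Kronecker_Approximation_Theorem"
begin

text \<open>
  \<open>M\<close> is the affine group of the real line, \<open>N\<close> the real line, \<open>g\<close> the logarithm of the scaling
  factor, and \<open>f\<close> the inclusion of the group \<open>A\<close> of integral translations. On \<open>A\<close> the composite is
  trivial, so \<open>A\<close> may be sent to a dense proper cyclic subgroup of the circle.

  In contrast, let \<open>h : M \<rightarrow> K\<close> be a Hausdorff factor of \<open>g\<close>; as \<open>N\<close> is Hausdorff, so is \<open>K\<close>. The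
  commutator of a scaling by \<open>exp t\<close> and a map with translation part \<open>b\<close> is the translation by
  \<open>(exp t - 1) b\<close>. Hence, unless \<open>h\<close> kills all translations, the elements of \<open>M\<close> that \<open>h\<close> maps into a
  small neighbourhood of the identity have bounded translation part, so \<open>h\<close> is closed by compactness.
  If \<open>h\<close> kills the translations, it is \<open>g\<close> followed by a section of \<open>K \<rightarrow> N\<close>, and \<open>g\<close> itself is
  c-closed: a closed subgroup with non-trivial image in \<open>N\<close> contains all translations or fixes a
  point of the line.
\<close>

section \<open>Topological groups\<close>

lemma openin_prod_topology_rectangle:
  assumes "openin (prod_topology X Y) S" "(x, y) \<in> S"
  obtains U V where "openin X U" "openin Y V" "x \<in> U" "y \<in> V" "U \<times> V \<subseteq> S"
  using assms unfolding openin_prod_topology_alt by meson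

lemma continuous_map_mult:
  assumes "topological_group K" "continuous_map X (topol K) f" "continuous_map X (topol K) g"
  shows "continuous_map X (topol K) (\<lambda>x. f x \<otimes>\<^bsub>K\<^esub> g x)"
proof -
  have "continuous_map X (prod_topology (topol K) (topol K)) (\<lambda>x. (f x, g x))"
    using assms(2,3) by (rule continuous_map_pairedI)
  moreover have "continuous_map (prod_topology (topol K) (topol K)) (topol K) (\<lambda>(x, y). x \<otimes>\<^bsub>K\<^esub> y)"
    using assms(1) by (simp add: topological_group_def)
  ultimately show ?thesis
    using continuous_map_compose by (fastforce simp: o_def)
qed

lemma continuous_map_m_inv:
  assumes "topological_group K" "continuous_map X (topol K) f"
  shows "continuous_map X (topol K) (\<lambda>x. inv\<^bsub>K\<^esub> (f x))"
  using assms continuous_map_compose[of X "topol K" f "topol K" "m_inv K"]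
  by (simp add: topological_group_def o_def)

text \<open>The commutator map is continuous and sends the pair of identities to the identity;
  intersecting the two sides of a rectangle gives one neighbourhood for both arguments.\<close>

lemma commutator_neighbourhood:
  assumes K: "topological_group K" and U: "openin (topol K) U" "\<one>\<^bsub>K\<^esub> \<in> U"
  obtains W where "openin (topol K) W" "\<one>\<^bsub>K\<^esub> \<in> W"
    "\<And>x y. x \<in> W \<Longrightarrow> y \<in> W \<Longrightarrow> x \<otimes>\<^bsub>K\<^esub> y \<otimes>\<^bsub>K\<^esub> inv\<^bsub>K\<^esub> x \<otimes>\<^bsub>K\<^esub> inv\<^bsub>K\<^esub> y \<in> U"
proof -
  interpret group K using K by (simp add: topological_group_def)
  let ?T = "topol K"
  have ts: "topspace ?T = carrier K" using K by (simp add: topological_group_def)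
  let ?c = "\<lambda>p. fst p \<otimes>\<^bsub>K\<^esub> snd p \<otimes>\<^bsub>K\<^esub> inv\<^bsub>K\<^esub> (fst p) \<otimes>\<^bsub>K\<^esub> inv\<^bsub>K\<^esub> (snd p)"
  have "continuous_map (prod_topology ?T ?T) ?T ?c"
    by (intro continuous_map_mult[OF K] continuous_map_m_inv[OF K] continuous_map_fst continuous_map_snd)
  then have "openin (prod_topology ?T ?T) {p \<in> topspace (prod_topology ?T ?T). ?c p \<in> U}"
    using U(1) by (rule openin_continuous_map_preimage)
  then obtain V W where VW: "openin ?T V" "openin ?T W" "\<one>\<^bsub>K\<^esub> \<in> V" "\<one>\<^bsub>K\<^esub> \<in> W"
      "V \<times> W \<subseteq> {p \<in> topspace (prod_topology ?T ?T). ?c p \<in> U}"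
    using U(2) by (elim openin_prod_topology_rectangle[where x = "\<one>\<^bsub>K\<^esub>" and y = "\<one>\<^bsub>K\<^esub>"])
      (simp_all add: ts)
  show thesis
  proof (rule that[of "V \<inter> W"])
    fix x y assume "x \<in> V \<inter> W" "y \<in> V \<inter> W"
    then have "(x, y) \<in> V \<times> W" by simp
    then show "x \<otimes>\<^bsub>K\<^esub> y \<otimes>\<^bsub>K\<^esub> inv\<^bsub>K\<^esub> x \<otimes>\<^bsub>K\<^esub> inv\<^bsub>K\<^esub> y \<in> U" using VW(5) by force
  qed (use VW in auto)
qed

text \<open>Points of different fibres are separated by preimages of open sets of \<open>Y\<close>,
  points of one fibre by \<open>fib\<close>. The gain is that compact subsets of \<open>K\<close>
  are closed and that equations between continuous maps into \<open>K\<close> define closed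
  sets.\<close>

lemma fibrewise_Hausdorff_over_Hausdorff:
  assumes ts: "topspace (topol K) = carrier K" and k: "continuous_map (topol K) Y k"
    and Y: "Hausdorff_space Y" and fib: "fibrewise_Hausdorff K k"
  shows "Hausdorff_space (topol K)"
  unfolding Hausdorff_space_def
proof (intro allI impI, elim conjE)
  fix x y assume xy: "x \<in> topspace (topol K)" "y \<in> topspace (topol K)" "x \<noteq> y"
  show "\<exists>U V. openin (topol K) U \<and> openin (topol K) V \<and> x \<in> U \<and> y \<in> V \<and> disjnt U V"
  proof (cases "k x = k y")
    case True
    then show ?thesis using xy fib ts unfolding fibrewise_Hausdorff_def by blast
  next
    case False
    have "k x \<in> topspace Y" "k y \<in> topspace Y"
      using k xy by (auto simp: continuous_map_def)
    with Y False obtain U V where UV: "openin Y U" "openin Y V" "k x \<in> U" "k y \<in> V" "disjnt U V"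
      unfolding Hausdorff_space_def by blast
    let ?P = "\<lambda>U. {z \<in> topspace (topol K). k z \<in> U}"
    have "openin (topol K) (?P U)" "openin (topol K) (?P V)"
      using k UV by (auto simp: continuous_map_def)
    moreover have "disjnt (?P U) (?P V)" using UV(5) by (auto simp: disjnt_def)
    ultimately show ?thesis using UV xy by blast
  qed
qed

text \<open>The two homomorphisms are mutually inverse on the carriers, so \<open>G'\<close> is a
  copy of \<open>G\<close> over another type. It serves to move the concrete groups to the type
  \<open>nat \<Rightarrow> nat\<close>.\<close>

lemma transport_topological_group:
  fixes G :: "'c tgroup" and \<phi> :: "'c \<Rightarrow> 'd"
  assumes G: "topological_group G" and inj: "inj_on \<phi> (carrier G)"
  obtains G' :: "'d tgroup" and \<psi> :: "'d \<Rightarrow> 'c"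
  where "topological_group G'" "carrier G' = \<phi> ` carrier G"
    "\<And>x. x \<in> carrier G \<Longrightarrow> \<psi> (\<phi> x) = x"
    "continuous_hom G G' \<phi>" "continuous_hom G' G \<psi>"
proof -
  interpret group G using G by (simp add: topological_group_def)
  have ts: "topspace (topol G) = carrier G" using G by (simp add: topological_group_def)
  obtain G' and \<psi> where G': "topological_group G'" "carrier G' = \<phi> ` carrier G"
    and \<psi>: "\<And>x. x \<in> carrier G \<Longrightarrow> \<psi> (\<phi> x) = x"
    and mult: "\<And>x y. x \<in> carrier G \<Longrightarrow> y \<in> carrier G \<Longrightarrow> \<phi> x \<otimes>\<^bsub>G'\<^esub> \<phi> y = \<phi> (x \<otimes>\<^bsub>G\<^esub> y)"
    and op: "\<And>S. openin (topol G') S \<longleftrightarrow> (\<exists>U. openin (topol G) U \<and> S = \<phi> ` (carrier G \<inter> U))"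
    using transport_subgroup[OF G subgroup_self inj] by metis
  have ts': "topspace (topol G') = \<phi> ` carrier G" using G' by (simp add: topological_group_def)
  show thesis
  proof (rule that[OF G' \<psi>])
    show "continuous_hom G G' \<phi>"
      unfolding continuous_hom_def continuous_map_def
    proof (intro conjI allI impI)
      fix S assume "openin (topol G') S"
      then obtain U where U: "openin (topol G) U" "S = \<phi> ` (carrier G \<inter> U)" by (auto simp: op)
      have "{x \<in> topspace (topol G). \<phi> x \<in> S} = carrier G \<inter> U"
        using inj by (auto simp: U(2) ts inj_on_def)
      then show "openin (topol G) {x \<in> topspace (topol G). \<phi> x \<in> S}"
        using U(1) ts by (metis openin_Int openin_topspace)
    qed (auto simp: G' mult ts ts' intro!: homI)
    show "continuous_hom G' G \<psi>"
      unfolding continuous_hom_def continuous_map_def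
    proof (intro conjI allI impI)
      fix U assume U: "openin (topol G) U"
      have "{x \<in> topspace (topol G'). \<psi> x \<in> U} = \<phi> ` (carrier G \<inter> U)"
        by (auto simp: ts' \<psi>)
      then show "openin (topol G') {x \<in> topspace (topol G'). \<psi> x \<in> U}"
        using U by (auto simp: op)
    qed (auto simp: G' mult \<psi> ts ts' intro!: homI)
  qed
qed

lemma continuous_hom_compose:
  assumes "continuous_hom G H f" "continuous_hom H K g"
  shows "continuous_hom G K (g \<circ> f)"
  using assms by (auto simp: continuous_hom_def hom_compose intro: continuous_map_compose)

section \<open>The affine group of the line over the group of its scaling factors\<close>

text \<open>The pair \<open>(b, s)\<close> stands for the map \<open>x \<mapsto> exp s * x + b\<close>.\<close>

definition affine_group :: "(real \<times> real) tgroup"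
  where "affine_group = \<lparr>carrier = UNIV,
    mult = (\<lambda>(b, s) (b', s'). (b + exp s * b', s + s')), one = (0, 0), topol = euclidean\<rparr>"

definition real_group :: "real tgroup"
  where "real_group = \<lparr>carrier = UNIV, mult = (+), one = 0, topol = euclidean\<rparr>"

lemma affine_group_simps [simp]:
  "carrier affine_group = UNIV" "topol affine_group = euclidean" "\<one>\<^bsub>affine_group\<^esub> = (0, 0)"
  "(b, s) \<otimes>\<^bsub>affine_group\<^esub> (b', s') = (b + exp s * b', s + s')"
  by (simp_all add: affine_group_def)

lemma real_group_simps [simp]:
  "carrier real_group = UNIV" "topol real_group = euclidean" "\<one>\<^bsub>real_group\<^esub> = 0"
  "x \<otimes>\<^bsub>real_group\<^esub> y = x + y"
  by (simp_all add: real_group_def)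

lemma exp_minus_cancel_left [simp]:
  fixes s b :: real
  shows "exp s * (exp (- s) * b) = b" "exp (- s) * (exp s * b) = b"
  by (simp_all flip: mult.assoc exp_add)

lemma group_affine: "group affine_group"
proof (rule groupI)
  fix x :: "real \<times> real"
  show "\<exists>y\<in>carrier affine_group. y \<otimes>\<^bsub>affine_group\<^esub> x = \<one>\<^bsub>affine_group\<^esub>"
    by (intro bexI[of _ "(- exp (- snd x) * fst x, - snd x)"]) (cases x, simp_all)
qed (auto simp: algebra_simps exp_add)

lemma inv_affine [simp]: "inv\<^bsub>affine_group\<^esub> (b, s) = (- exp (- s) * b, - s)"
  by (rule group.inv_equality[OF group_affine]) auto

lemma topological_group_affine: "topological_group affine_group"
proof -
  have "m_inv affine_group = (\<lambda>p. (- exp (- snd p) * fst p, - snd p))"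
    by auto
  moreover have "(\<lambda>(x, y). x \<otimes>\<^bsub>affine_group\<^esub> y)
      = (\<lambda>p. (fst (fst p) + exp (snd (fst p)) * fst (snd p), snd (fst p) + snd (snd p)))"
    by auto
  ultimately show ?thesis
    using group_affine
    by (auto simp: topological_group_def simp flip: euclidean_product_topology
        intro!: continuous_intros)
qed

lemma topological_group_real: "topological_group real_group"
proof -
  have g: "group real_group"
    by (rule groupI) (auto intro: exI[of _ "- x" for x])
  have "m_inv real_group = uminus"
    by (rule ext, rule group.inv_equality[OF g]) auto
  moreover have "(\<lambda>(x, y). x \<otimes>\<^bsub>real_group\<^esub> y) = (\<lambda>p. fst p + snd p)"
    by auto
  ultimately show ?thesis
    using g
    by (auto simp: topological_group_def simp flip: euclidean_product_topology
        intro!: continuous_intros)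
qed

lemma continuous_hom_snd: "continuous_hom affine_group real_group snd"
  by (auto simp: continuous_hom_def hom_def continuous_on_snd)

text \<open>Unless the image is \<open>{0}\<close>, it is the preimage of \<open>B\<close> under a
  continuous section \<open>s \<mapsto> (q s, s)\<close> of \<open>snd\<close>: \<open>q\<close> is
  zero if \<open>B\<close> contains all translations, and \<open>q s = p * (1 - exp s)\<close> if
  \<open>B\<close> fixes the point \<open>p\<close>.\<close>

lemma closed_snd_subgroup_affine:
  assumes B: "subgroup B affine_group" and cl: "closed B"
  shows "closed (snd ` B)"
proof -
  interpret subgroup B affine_group by (rule B)
  have mult: "(b + exp s * b', s + s') \<in> B" if "(b, s) \<in> B" "(b', s') \<in> B" for b s b' s'
    using m_closed[OF that] by simp
  have inv: "(- exp (- s) * b, - s) \<in> B" if "(b, s) \<in> B" for b s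
    using m_inv_closed[OF that] by simp
  have section_closed: "closed (snd ` B)"
    if q: "continuous_on UNIV q" and eq: "snd ` B = {s. (q s, s) \<in> B}" for q :: "real \<Rightarrow> real"
  proof -
    have "continuous_on UNIV (\<lambda>s. (q s, s))" by (intro continuous_intros q)
    then have "closed ((\<lambda>s. (q s, s)) -` B)" using cl closed_vimage by blast
    then show ?thesis by (simp add: eq vimage_def)
  qed
  \<comment> \<open>Commutators are translations, so in the last case any two elements of
    \<open>B\<close> commute.\<close>
  consider (vertical) "\<And>b s. (b, s) \<in> B \<Longrightarrow> s = 0"
    | (dense) b0 s0 c where "(b0, s0) \<in> B" "s0 \<noteq> 0" "(c, 0) \<in> B" "c \<noteq> 0"
    | (commutative) b0 s0 where "(b0, s0) \<in> B" "s0 \<noteq> 0" "\<And>c. (c, 0) \<in> B \<Longrightarrow> c = 0"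
    by blast
  then show ?thesis
  proof cases
    case vertical
    then have "snd ` B = {0}" using one_closed by force
    then show ?thesis by simp
  next
    case dense
    \<comment> \<open>Passing to the inverse if necessary gives a contracting element of
      \<open>B\<close>.\<close>
    obtain b1 s1 where neg: "(b1, s1) \<in> B" "s1 < 0"
      using dense(1,2) inv[OF dense(1)] by (metis linorder_neqE_linordered_idom neg_less_0_iff_less)
    have add: "(x + y, 0) \<in> B" if "(x, 0) \<in> B" "(y, 0) \<in> B" for x y
      using mult[OF that] by simp
    have minus: "(- x, 0) \<in> B" if "(x, 0) \<in> B" for x
      using inv[OF that] by simp
    \<comment> \<open>Conjugation by \<open>(b1, s1)\<close> multiplies a translation by
      \<open>exp s1 < 1\<close>; iterating it on \<open>c\<close> yields arbitrarily short non-zero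
      translations in \<open>B\<close>.\<close>
    have scale: "(exp s1 * x, 0) \<in> B" if x: "(x, 0) \<in> B" for x
      using mult[OF mult[OF neg(1) x] inv[OF neg(1)]] by simp
    have powers: "(exp s1 ^ n * c, 0) \<in> B" for n
      by (induction n) (use dense scale in \<open>auto simp: mult.assoc\<close>)
    have nat_mult: "(real n * x, 0) \<in> B" if "(x, 0) \<in> B" for n x
      by (induction n) (use that one_closed add in \<open>auto simp: algebra_simps\<close>)
    have int_mult: "(of_int m * x, 0) \<in> B" if "(x, 0) \<in> B" for m x
      using nat_mult[OF that, of "nat m"] minus[OF nat_mult[OF that, of "nat (- m)"]]
      by (cases "m \<ge> 0") auto
    have all: "(x, 0) \<in> B" for x
    proof -
      have "(x, 0) \<in> closure B"
        unfolding closure_approachable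
      proof (intro allI impI)
        fix e :: real assume e: "e > 0"
        have "(\<lambda>n. exp s1 ^ n * c) \<longlonglongrightarrow> 0 * c"
          using neg by (intro tendsto_intros LIMSEQ_power_zero) auto
        then have "\<forall>\<^sub>F n in sequentially. dist (exp s1 ^ n * c) 0 < e"
          using e by (simp add: tendsto_iff)
        then obtain n where n: "dist (exp s1 ^ n * c) 0 < e"
          by (meson eventually_sequentially order_refl)
        \<comment> \<open>Some integer multiple of the short translation \<open>d\<close> lies
          within |d| < e of \<open>x\<close>.\<close>
        define d where "d = exp s1 ^ n * c"
        have d: "d \<noteq> 0" "\<bar>d\<bar> < e" using n dense by (auto simp: d_def)
        have "of_int \<lfloor>x / d\<rfloor> * d - x = (of_int \<lfloor>x / d\<rfloor> - x / d) * d"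
          using d by (simp add: field_simps)
        then have "\<bar>of_int \<lfloor>x / d\<rfloor> * d - x\<bar> = \<bar>of_int \<lfloor>x / d\<rfloor> - x / d\<bar> * \<bar>d\<bar>"
          by (simp add: abs_mult)
        also have "\<dots> \<le> 1 * \<bar>d\<bar>" by (intro mult_right_mono) linarith+
        finally have "dist (of_int \<lfloor>x / d\<rfloor> * d, 0) (x, 0) < e"
          using d by (simp add: dist_Pair_Pair dist_real_def)
        moreover have "(of_int \<lfloor>x / d\<rfloor> * d, 0) \<in> B"
          unfolding d_def by (rule int_mult[OF powers])
        ultimately show "\<exists>y\<in>B. dist y (x, 0) < e" by blast
      qed
      then show ?thesis using cl by simp
    qed
    have "(0, s) \<in> B" if "(b, s) \<in> B" for b s
      using mult[OF all[of "- b"] that] by simp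
    then show ?thesis
      by (intro section_closed[of "\<lambda>_. 0"]) force+
  next
    case commutative
    \<comment> \<open>This is the fixed point of \<open>(b0, s0)\<close>. The commutator of
      \<open>(b0, s0)\<close> with an element of \<open>B\<close> is a translation in
      \<open>B\<close>, hence trivial; commuting with \<open>(b0, s0)\<close>, the element must fix
      \<open>p\<close> too, which is the equation for \<open>b\<close>.\<close>
    define p where "p = b0 / (1 - exp s0)"
    have "b = p * (1 - exp s)" if bs: "(b, s) \<in> B" for b s
    proof -
      have "(b0 + exp s0 * b - (b + exp s * b0), 0) \<in> B"
        using mult[OF mult[OF mult[OF commutative(1) bs] inv[OF commutative(1)]] inv[OF bs]]
        by (simp add: algebra_simps flip: exp_add)
      then have "b0 + exp s0 * b - (b + exp s * b0) = 0" by (rule commutative(3))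
      then show ?thesis using commutative(2) by (simp add: p_def field_simps)
    qed
    then have "snd ` B = {s. (p * (1 - exp s), s) \<in> B}" by force
    then show ?thesis
      by (intro section_closed[of "\<lambda>s. p * (1 - exp s)"] continuous_intros)
  qed
qed

text \<open>Both cases rest on \<open>K\<close> being Hausdorff: if translations are killed, the
  image is cut out by an equation between continuous maps; otherwise it is locally the image of a
  compact set.\<close>

lemma c_closed_affine_factor:
  fixes K :: "'c tgroup"
  assumes F: "Hausdorff_factorization affine_group real_group snd K h k"
  shows "c_closed affine_group K h"
  unfolding c_closed_def
proof (intro allI impI, elim conjE)
  fix B assume B: "subgroup B affine_group" and "closedin (topol affine_group) B"
  then have cl: "closed B" by simp
  let ?T = "topol K"
  have K: "topological_group K" and hh: "h \<in> hom affine_group K"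
    and hc: "continuous_map euclidean ?T h"
    and kh: "k \<in> hom K real_group" and kc: "continuous_map ?T euclidean k"
    and haus: "fibrewise_Hausdorff K k" and kh_eq: "\<And>x. k (h x) = snd x"
    using F by (auto simp: Hausdorff_factorization_def continuous_hom_def)
  interpret K: group K using K by (simp add: topological_group_def)
  interpret h: group_hom affine_group K h
    using hh group_affine by (simp add: group_hom_def group_hom_axioms_def K.group_axioms)
  have ts: "topspace ?T = carrier K" using K by (simp add: topological_group_def)
  have hK [simp]: "h x \<in> carrier K" for x using h.hom_closed[of x] by simp
  have Haus: "Hausdorff_space ?T"
    by (rule fibrewise_Hausdorff_over_Hausdorff[OF ts kc _ haus]) simp
  have h_mult: "h (b, s) \<otimes>\<^bsub>K\<^esub> h (b', s') = h (b + exp s * b', s + s')" for b s b' s'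
    using h.hom_mult[of "(b, s)" "(b', s')"] by simp
  have h_inv: "inv\<^bsub>K\<^esub> h (b, s) = h (- exp (- s) * b, - s)" for b s
    using h.hom_inv[of "(b, s)"] by simp
  have h_one: "h (0, 0) = \<one>\<^bsub>K\<^esub>" using h.hom_one by simp
  have \<sigma>c: "continuous_map euclidean ?T (\<lambda>s. h (0, s))"
  proof -
    have "continuous_map euclidean euclidean (\<lambda>s :: real. (0 :: real, s))"
      by (simp add: continuous_intros)
    from continuous_map_compose[OF this hc] show ?thesis by (simp add: o_def)
  qed
  show "closedin ?T (h ` B)"
  proof (cases "h (1, 0) = \<one>\<^bsub>K\<^esub>")
    case True
    \<comment> \<open>The translation by \<open>b\<close> is conjugate to the translation by 1 under
      the scaling by \<open>b\<close>; negative \<open>b\<close> then follow by inversion.\<close>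
    have pos: "h (b, 0) = \<one>\<^bsub>K\<^esub>" if "b > 0" for b
    proof -
      have "h (0, ln b) \<otimes>\<^bsub>K\<^esub> h (1, 0) \<otimes>\<^bsub>K\<^esub> inv\<^bsub>K\<^esub> h (0, ln b) = h (b, 0)"
        using that by (simp add: h_mult h_inv)
      then show ?thesis by (simp add: True)
    qed
    have triv: "h (b, 0) = \<one>\<^bsub>K\<^esub>" for b
    proof (cases b "0 :: real" rule: linorder_cases)
      case less
      then show ?thesis using pos[of "- b"] h_inv[of "- b" 0] by simp
    qed (use pos h_one in auto)
    have h_eq: "h x = h (0, snd x)" for x
      using h_mult[of "fst x" 0 0 "snd x"] triv[of "fst x"] by simp
    \<comment> \<open>As \<open>h\<close> now factors through \<open>snd\<close>, the map
      \<open>s \<mapsto> h (0, s)\<close> is a section of \<open>k\<close> whose range is the whole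
      image of \<open>h\<close>. The set of fixed points of this section after \<open>k\<close> is
      that range.\<close>
    have "closedin ?T {x \<in> topspace ?T. h (0, k x) = x}"
      using continuous_map_compose[OF kc \<sigma>c]
      by (intro closedin_continuous_maps_eq[OF Haus]) (simp_all add: o_def)
    moreover have "closedin ?T {x \<in> topspace ?T. k x \<in> snd ` B}"
      using closed_snd_subgroup_affine[OF B cl]
      by (intro closedin_continuous_map_preimage[OF kc]) simp
    moreover have "h ` B = {x \<in> topspace ?T. h (0, k x) = x} \<inter> {x \<in> topspace ?T. k x \<in> snd ` B}"
    proof (intro equalityI subsetI)
      fix x assume "x \<in> h ` B"
      then obtain y where "y \<in> B" "x = h y" by auto
      then have "x = h (0, snd y)" "snd y \<in> snd ` B" using h_eq[of y] by auto
      then show "x \<in> {x \<in> topspace ?T. h (0, k x) = x} \<inter> {x \<in> topspace ?T. k x \<in> snd ` B}"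
        by (simp add: ts kh_eq)
    next
      fix x assume "x \<in> {x \<in> topspace ?T. h (0, k x) = x} \<inter> {x \<in> topspace ?T. k x \<in> snd ` B}"
      then obtain y where "y \<in> B" "h (0, snd y) = x" by auto
      then show "x \<in> h ` B" using h_eq[of y] by (metis image_eqI)
    qed
    ultimately show ?thesis by auto
  next
    case False
    then have "\<exists>U V. openin ?T U \<and> openin ?T V \<and> \<one>\<^bsub>K\<^esub> \<in> U \<and> h (1, 0) \<in> V \<and> disjnt U V"
      by (intro Haus[unfolded Hausdorff_space_def, rule_format]) (simp add: ts eq_commute)
    then obtain U V where "openin ?T U" "\<one>\<^bsub>K\<^esub> \<in> U" "h (1, 0) \<in> V" "disjnt U V"
      by blast
    then have U: "openin ?T U" "\<one>\<^bsub>K\<^esub> \<in> U" "h (1, 0) \<notin> U"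
      by (auto simp: disjnt_iff)
    obtain W where W: "openin ?T W" "\<one>\<^bsub>K\<^esub> \<in> W"
      and comm: "\<And>x y. x \<in> W \<Longrightarrow> y \<in> W \<Longrightarrow> x \<otimes>\<^bsub>K\<^esub> y \<otimes>\<^bsub>K\<^esub> inv\<^bsub>K\<^esub> x \<otimes>\<^bsub>K\<^esub> inv\<^bsub>K\<^esub> y \<in> U"
      using commutator_neighbourhood[OF K U(1,2)] by metis
    have "open {s. h (0, s) \<in> W}" "0 \<in> {s. h (0, s) \<in> W}"
      using openin_continuous_map_preimage[OF \<sigma>c W(1)] W(2) by (simp_all add: h_one)
    then obtain e where "e > 0" "ball 0 e \<subseteq> {s. h (0, s) \<in> W}"
      using open_contains_ball_eq by metis
    then have e: "e > 0" "\<And>s. \<bar>s\<bar> < e \<Longrightarrow> h (0, s) \<in> W"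
      by auto
    \<comment> \<open>For |b| > C the number 1 / b is smaller in absolute value than 1 - exp (- e /
      2), which puts \<open>ln (1 + 1 / b)\<close> within e / 2 of 0. The summand 1 ensures C >
      1.\<close>
    define C where "C = 1 + 1 / (1 - exp (- e / 2))"
    have translation_bound: "\<bar>b\<bar> \<le> C" if bs: "h (b, s) \<in> W" for b s
    proof (rule ccontr)
      \<comment> \<open>Otherwise some commutator of \<open>(b, s)\<close> with a small scaling is the translation by \<open>1\<close>.\<close>
      assume "\<not> \<bar>b\<bar> \<le> C"
      then have big: "\<bar>b\<bar> > C" by simp
      have q: "0 < 1 - exp (- e / 2)" "1 - exp (- e / 2) < 1" using e by auto
      then have "C > 1" by (simp add: C_def)
      have "\<bar>b\<bar> > 1 / (1 - exp (- e / 2))" using big by (simp add: C_def)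
      then have small: "\<bar>1 / b\<bar> < 1 - exp (- e / 2)"
        using q \<open>C > 1\<close> big by (simp add: field_simps)
      then have pos: "1 + 1 / b > exp (- e / 2)" by linarith
      then have "1 + 1 / b > 0" by (smt (verit) exp_gt_zero)
      define t where "t = ln (1 + 1 / b)"
      have et: "exp t = 1 + 1 / b" using \<open>1 + 1 / b > 0\<close> by (simp add: t_def)
      have "t > - e / 2" using pos unfolding et[symmetric] by simp
      moreover have "t < e / 2"
      proof -
        \<comment> \<open>The square yields exp (e / 2) + exp (- e / 2) \<ge> 2, so the bound exp t
          < 2 - exp (- e / 2) gives exp t < exp (e / 2).\<close>
        have "(exp (e / 2) - 1)\<^sup>2 \<ge> 0" by simp
        then have "exp (e / 2) * (exp (e / 2) - 2 + exp (- e / 2)) \<ge> 0"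
          by (simp add: algebra_simps power2_eq_square flip: exp_add)
        then have "exp (e / 2) - 2 + exp (- e / 2) \<ge> 0"
          by (simp add: zero_le_mult_iff)
        then have "exp t < exp (e / 2)" using small et by linarith
        then show ?thesis by simp
      qed
      ultimately have "h (0, t) \<in> W" using e by (intro e(2)) auto
      from comm[OF this bs] have "h ((exp t - 1) * b, 0) \<in> U"
        by (simp add: h_mult h_inv algebra_simps flip: exp_add)
      moreover have "(exp t - 1) * b = 1" using big \<open>C > 1\<close> by (auto simp: et)
      ultimately show False using U(3) by simp
    qed
    \<comment> \<open>The condition on \<open>k\<close> bounds the scaling part as
      \<open>translation_bound\<close> bounds the translation part: elements that \<open>h\<close>
      sends into \<open>W'\<close> lie in a compact box.\<close>
    define W' where "W' = {x \<in> topspace ?T. x \<in> W \<and> k x \<in> {-1<..<1}}"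
    have W': "openin ?T W'"
    proof -
      have "openin ?T {x \<in> topspace ?T. k x \<in> {-1<..<1}}"
        by (rule openin_continuous_map_preimage[OF kc]) simp
      moreover have "W' = W \<inter> {x \<in> topspace ?T. k x \<in> {-1<..<1}}"
        by (auto simp: W'_def)
      ultimately show ?thesis using W(1) by auto
    qed
    have "\<one>\<^bsub>K\<^esub> \<in> W'" using W(2) kh_eq[of "(0, 0)"] by (simp add: W'_def ts h_one)
    have compact_image: "closedin ?T (h ` (B \<inter> Q))" if "compact Q" for Q
    proof (rule compactin_imp_closedin[OF Haus], rule image_compactin[OF _ hc])
      show "compactin euclidean (B \<inter> Q)" using cl that by (simp add: closed_Int_compact)
    qed
    have "?T closure_of (h ` B) \<subseteq> h ` B"
    proof
      fix x assume x: "x \<in> ?T closure_of (h ` B)"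
      then have xK: "x \<in> carrier K" using ts closure_of_subset_topspace by fastforce
      \<comment> \<open>Two points of a small neighbourhood \<open>V\<close> of \<open>x\<close>
        have quotient in \<open>W'\<close>, so all elements that \<open>h\<close> maps into
        \<open>V\<close> lie in a single translate \<open>Q\<close> of the compact box.\<close>
      let ?d = "\<lambda>p. inv\<^bsub>K\<^esub> (fst p) \<otimes>\<^bsub>K\<^esub> snd p"
      have "continuous_map (prod_topology ?T ?T) ?T ?d"
        by (intro continuous_map_mult[OF K] continuous_map_m_inv[OF K] continuous_map_fst continuous_map_snd)
      then have "openin (prod_topology ?T ?T) {p \<in> topspace (prod_topology ?T ?T). ?d p \<in> W'}"
        using W' by (rule openin_continuous_map_preimage)
      then obtain V1 V2 where V: "openin ?T V1" "openin ?T V2" "x \<in> V1" "x \<in> V2"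
        "V1 \<times> V2 \<subseteq> {p \<in> topspace (prod_topology ?T ?T). ?d p \<in> W'}"
        using xK \<open>\<one>\<^bsub>K\<^esub> \<in> W'\<close>
        by (elim openin_prod_topology_rectangle[where x = x and y = x]) (simp_all add: ts)
      define V where "V = V1 \<inter> V2"
      have V': "openin ?T V" "x \<in> V" using V by (auto simp: V_def)
      have dW: "inv\<^bsub>K\<^esub> y \<otimes>\<^bsub>K\<^esub> z \<in> W'" if "y \<in> V" "z \<in> V" for y z
      proof -
        have "(y, z) \<in> V1 \<times> V2" using that by (simp add: V_def)
        then show ?thesis using V(5) by force
      qed
      \<comment> \<open>Since \<open>x\<close> is not known to be in the image of \<open>h\<close>,
        the box is translated by an element of \<open>B\<close> mapped into
        \<open>V\<close>.\<close>
      obtain b0 s0 where m: "(b0, s0) \<in> B" "h (b0, s0) \<in> V"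
        using x V' unfolding in_closure_of by (metis imageE surj_pair)
      define Q where "Q = (\<lambda>p. (b0, s0) \<otimes>\<^bsub>affine_group\<^esub> p) ` ({- C..C} \<times> {- 1..1})"
      have "Q = (\<lambda>p. (b0 + exp s0 * fst p, s0 + snd p)) ` ({- C..C} \<times> {- 1..1})"
        unfolding Q_def by (rule image_cong) auto
      also have "compact \<dots>"
        by (intro compact_continuous_image continuous_intros compact_Times) auto
      finally have Q: "compact Q" .
      have near: "p \<in> Q" if "h p \<in> V" for p
      proof -
        obtain b s where p: "p = (b, s)" by (cases p)
        define r where "r = (exp (- s0) * (b - b0), s - s0)"
        have "inv\<^bsub>K\<^esub> h (b0, s0) \<otimes>\<^bsub>K\<^esub> h p = h r"
          by (simp add: p r_def h_mult h_inv algebra_simps)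
        then have "h r \<in> W'" using dW[OF m(2) that] by simp
        then have "\<bar>fst r\<bar> \<le> C" "\<bar>snd r\<bar> \<le> 1"
          using translation_bound[of "fst r" "snd r"] kh_eq[of r] by (auto simp: W'_def)
        moreover have "p = (b0, s0) \<otimes>\<^bsub>affine_group\<^esub> r"
          by (simp add: p r_def flip: exp_add mult.assoc)
        ultimately show ?thesis
          unfolding Q_def by (intro image_eqI[where x = r]) (auto simp: mem_Times_iff)
      qed
      \<comment> \<open>Inside \<open>V\<close> only \<open>B \<inter> Q\<close> contributes to the
        image, and the image of this compact set is closed.\<close>
      have "x \<in> ?T closure_of (h ` (B \<inter> Q))"
        unfolding in_closure_of
      proof (intro conjI allI impI)
        fix S assume S: "x \<in> S \<and> openin ?T S"
        then have "x \<in> S \<inter> V" "openin ?T (S \<inter> V)" using V' by auto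
        then obtain y where "y \<in> h ` B" "y \<in> S \<inter> V" using x unfolding in_closure_of by metis
        then show "\<exists>y. y \<in> h ` (B \<inter> Q) \<and> y \<in> S" using near by auto
      qed (use xK ts in simp)
      then show "x \<in> h ` B"
        using compact_image[OF Q] closure_of_closedin by blast
    qed
    then show ?thesis
      by (subst closure_of_subset_eq[symmetric]) (auto simp: ts)
  qed
qed

section \<open>The integers and the circle\<close>

definition int_group :: "int tgroup"
  where "int_group = \<lparr>carrier = UNIV, mult = (+), one = 0, topol = discrete_topology UNIV\<rparr>"

definition circle_group :: "complex tgroup"
  where "circle_group = \<lparr>carrier = sphere 0 1, mult = (*), one = 1, topol = top_of_set (sphere 0 1)\<rparr>"

lemma int_group_simps [simp]:
  "carrier int_group = UNIV" "topol int_group = discrete_topology UNIV" "\<one>\<^bsub>int_group\<^esub> = 0"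
  "x \<otimes>\<^bsub>int_group\<^esub> y = x + y"
  by (simp_all add: int_group_def)

lemma circle_group_simps [simp]:
  "carrier circle_group = sphere 0 1" "topol circle_group = top_of_set (sphere 0 1)"
  "\<one>\<^bsub>circle_group\<^esub> = 1" "x \<otimes>\<^bsub>circle_group\<^esub> y = x * y"
  by (simp_all add: circle_group_def)

lemma topological_group_int: "topological_group int_group"
proof -
  have "group int_group"
    by (rule groupI) (auto intro: exI[of _ "- x" for x])
  then show ?thesis
    by (simp add: topological_group_def flip: prod_topology_discrete_topology)
qed

lemma topological_group_circle: "topological_group circle_group"
proof -
  have g: "group circle_group"
    by (rule groupI) (auto simp: norm_mult norm_inverse intro!: bexI[of _ "inverse x" for x] left_inverse)
  have inv: "inv\<^bsub>circle_group\<^esub> x = inverse x" if "x \<in> sphere 0 1" for x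
  proof (rule group.inv_equality[OF g])
    have "x \<noteq> 0" using that by auto
    then show "inverse x \<otimes>\<^bsub>circle_group\<^esub> x = \<one>\<^bsub>circle_group\<^esub>" by simp
  qed (use that in \<open>auto simp: norm_inverse\<close>)
  have "continuous_on (sphere 0 1) (\<lambda>x :: complex. inverse x)"
    by (intro continuous_intros) auto
  then have "continuous_on (sphere 0 1) (m_inv circle_group)"
    by (rule continuous_on_eq) (simp add: inv)
  moreover have "m_inv circle_group ` sphere 0 1 \<subseteq> sphere 0 1"
    by (auto simp: inv norm_inverse)
  moreover have "(\<lambda>(x, y). x \<otimes>\<^bsub>circle_group\<^esub> y) = (\<lambda>p. fst p * snd p)"
    by auto
  moreover have "continuous_on (sphere 0 1 \<times> sphere 0 1) (\<lambda>p :: complex \<times> complex. fst p * snd p)"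
    by (intro continuous_intros)
  ultimately show ?thesis
    using g by (auto simp: topological_group_def norm_mult simp flip: subtopology_Times euclidean_product_topology)
qed

text \<open>The powers of the rotation by \<theta> full turns.\<close>

definition rotation :: "real \<Rightarrow> int \<Rightarrow> complex"
  where "rotation \<theta> n = cis (2 * pi * (of_int n * \<theta>))"

lemma continuous_hom_rotation: "continuous_hom int_group circle_group (rotation \<theta>)"
  by (auto simp: continuous_hom_def hom_def rotation_def cis_mult algebra_simps)

text \<open>The point -1 is in the closure but not in the range: fractional parts of multiples of
  \<theta> approach 1 / 2, whereas \<open>rotation \<theta> n = -1\<close> would make 2 n \<theta>
  an odd integer and \<theta> rational.\<close>

lemma not_closed_range_rotation:
  assumes \<theta>: "\<theta> \<notin> \<rat>"
  shows "\<not> closedin (topol circle_group) (range (rotation \<theta>))"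
proof
  assume "closedin (topol circle_group) (range (rotation \<theta>))"
  then have cl: "closed (range (rotation \<theta>))"
    by (auto intro: closedin_closed_trans)
  have "-1 \<in> closure (range (rotation \<theta>))"
    unfolding closure_approachable
  proof (intro allI impI)
    fix e :: real assume "e > 0"
    have "continuous_on UNIV (\<lambda>x. cis (2 * pi * x))" by (intro continuous_intros)
    then have "isCont (\<lambda>x. cis (2 * pi * x)) (1 / 2)"
      by (simp add: continuous_on_eq_continuous_at)
    then obtain d where d: "d > 0" "\<And>x. dist x (1 / 2) < d \<Longrightarrow> dist (cis (2 * pi * x)) (cis (2 * pi * (1 / 2))) < e"
      using \<open>e > 0\<close> unfolding continuous_at_eps_delta by blast
    \<comment> \<open>Kronecker density at 1 / 2; subtracting the integer \<open>m\<close> does not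
      change the point of the circle.\<close>
    obtain m n :: int where "\<bar>of_int n * \<theta> - of_int m - 1 / 2\<bar> < d"
      using sequence_of_fractional_parts_is_dense[OF \<theta> d(1)] by metis
    then have "dist (cis (2 * pi * (of_int n * \<theta> - of_int m))) (-1) < e"
      using d(2)[of "of_int n * \<theta> - of_int m"] by (simp add: dist_real_def)
    also have "cis (2 * pi * (of_int n * \<theta> - of_int m)) = rotation \<theta> n"
      by (simp add: rotation_def right_diff_distrib flip: cis_divide)
    finally show "\<exists>y\<in>range (rotation \<theta>). dist y (-1) < e" by blast
  qed
  then obtain n where "cis (2 * pi * (of_int n * \<theta>)) = -1"
    using cl by (auto simp: rotation_def)
  then have "cos (2 * pi * (of_int n * \<theta>)) = -1"
    by (metis cis.sel(1) one_complex.sel(1) uminus_complex.sel(1))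
  then obtain m :: int where "2 * pi * (of_int n * \<theta>) = of_int m * 2 * pi + pi"
    by (auto simp: cos_eq_minus1 algebra_simps)
  then have "pi * (2 * of_int n * \<theta>) = pi * (2 * of_int m + 1)"
    by (simp add: algebra_simps)
  then have *: "2 * of_int n * \<theta> = 2 * of_int m + 1" by simp
  \<comment> \<open>For n = 0 an odd integer would vanish; this permits division by
    \<open>n\<close>.\<close>
  have "n \<noteq> 0"
  proof
    assume "n = 0"
    with * have "of_int (2 * m + 1) = (0 :: real)" by simp
    then show False by (simp only: of_int_eq_0_iff) presburger
  qed
  with * have "\<theta> = of_int (2 * m + 1) / of_int (2 * n)"
    by (simp add: field_simps)
  then show False using \<theta> by (metis Rats_divide Rats_of_int)
qed

text \<open>For an injective continuous map properness amounts to closedness, and every set of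
  integers is closed in the line.\<close>

lemma proper_map_int_affine:
  "proper_map (discrete_topology UNIV) euclidean (\<lambda>n :: int. (of_int n :: real, 0 :: real))"
proof (subst injective_imp_proper_eq_closed_map)
  show "inj_on (\<lambda>n :: int. (of_int n :: real, 0 :: real)) (topspace (discrete_topology UNIV))"
    by (auto simp: inj_on_def)
  have "closed ((\<lambda>n :: int. (of_int n :: real, 0 :: real)) ` S)" for S
  proof -
    have "(\<lambda>n :: int. (of_int n :: real, 0 :: real)) ` S = of_int ` S \<times> {0}" by auto
    then show ?thesis by (simp add: closed_Times closed_of_int_image)
  qed
  then show "closed_map (discrete_topology UNIV) euclidean (\<lambda>n :: int. (of_int n :: real, 0 :: real))"
    by (simp add: closed_map_def)
qed

section \<open>The counterexample\<close>

text \<open>The floors of x n determine x: reals with equal floors satisfy n |x - y| < 1 for all n,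
  against the Archimedean property. Coding pairs of integers by naturals turns the floors into a
  sequence.\<close>

lemma ex_inj_real_pair: "\<exists>\<phi> :: real \<times> real \<Rightarrow> nat \<Rightarrow> nat. inj \<phi>"
proof -
  define \<phi> :: "real \<times> real \<Rightarrow> nat \<Rightarrow> nat"
    where "\<phi> p n = to_nat (\<lfloor>fst p * real n\<rfloor>, \<lfloor>snd p * real n\<rfloor>)" for p n
  have eq: "x = y" if "\<And>n. \<lfloor>x * real n\<rfloor> = \<lfloor>y * real n\<rfloor>" for x y :: real
  proof (rule ccontr)
    assume "x \<noteq> y"
    then obtain n where n: "real n * \<bar>x - y\<bar> > 1"
      using reals_Archimedean3[of "\<bar>x - y\<bar>"] by auto
    have "\<bar>x * real n - y * real n\<bar> < 1" using that[of n] by linarith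
    then show False using n by (simp add: abs_mult mult.commute flip: left_diff_distrib)
  qed
  have "inj \<phi>"
  proof (rule injI)
    fix p q assume "\<phi> p = \<phi> q"
    then have "\<phi> p n = \<phi> q n" for n by simp
    then have "fst p = fst q" "snd p = snd q" by (auto simp: \<phi>_def intro!: eq)
    then show "p = q" by (simp add: prod_eq_iff)
  qed
  then show ?thesis by blast
qed

theorem corollary3p9:
  assumes "continuum_hypothesis"
  shows "\<exists>(A :: (nat \<Rightarrow> nat) tgroup) (M :: (nat \<Rightarrow> nat) tgroup) (N :: (nat \<Rightarrow> nat) tgroup) f g.
    topological_group A \<and> topological_group M \<and> topological_group N \<and>
    continuous_hom A M f \<and> continuous_hom M N g \<and>
    proper_map (topol A) (topol M) f \<and>
    c_complete M N g \<and>
    \<not> h_complete A N (g \<circ> f)"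
proof -
  obtain \<phi> :: "real \<times> real \<Rightarrow> nat \<Rightarrow> nat" where \<phi>: "inj \<phi>" using ex_inj_real_pair by blast
  \<comment> \<open>Restricting \<open>\<phi>\<close> to the axes also embeds the reals and the
    integers.\<close>
  have "inj (\<lambda>s. \<phi> (0, s))" "inj (\<lambda>n :: int. \<phi> (of_int n, 0))"
    by (auto intro!: injI dest!: injD[OF \<phi>])
  then obtain \<iota> :: "int \<Rightarrow> nat \<Rightarrow> nat" and \<nu> :: "real \<Rightarrow> nat \<Rightarrow> nat" where \<iota>: "inj \<iota>" and \<nu>: "inj \<nu>"
    by blast
  obtain A \<alpha> where A: "topological_group A" "carrier A = range \<iota>" "\<And>x. \<alpha> (\<iota> x) = x"
      "continuous_hom int_group A \<iota>" "continuous_hom A int_group \<alpha>"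
    using transport_topological_group[OF topological_group_int, of \<iota>] \<iota> by auto
  obtain M \<mu> where M: "topological_group M" "carrier M = range \<phi>" "\<And>x. \<mu> (\<phi> x) = x"
      "continuous_hom affine_group M \<phi>" "continuous_hom M affine_group \<mu>"
    using transport_topological_group[OF topological_group_affine, of \<phi>] \<phi> by auto
  obtain N \<rho> where N: "topological_group N" "carrier N = range \<nu>" "\<And>x. \<rho> (\<nu> x) = x"
      "continuous_hom real_group N \<nu>" "continuous_hom N real_group \<rho>"
    using transport_topological_group[OF topological_group_real, of \<nu>] \<nu> by auto
  define j :: "int \<Rightarrow> real \<times> real" where "j n = (of_int n, 0)" for n
  define f where "f = \<phi> \<circ> j \<circ> \<alpha>"
  define g where "g = \<nu> \<circ> snd \<circ> \<mu>"
  have "continuous_hom int_group affine_group j"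
    by (auto simp: continuous_hom_def hom_def j_def)
  then have f: "continuous_hom A M f"
    unfolding f_def using A M by (intro continuous_hom_compose)
  have g: "continuous_hom M N g"
    unfolding g_def o_assoc[symmetric]
    using M N continuous_hom_snd by (intro continuous_hom_compose)
  have tsA: "topspace (topol A) = range \<iota>" and tsM: "topspace (topol M) = range \<phi>"
    using A M by (auto simp: topological_group_def)
  \<comment> \<open>The transport maps are homeomorphisms, hence proper, which reduces properness of
    \<open>f\<close> to that of \<open>j\<close>.\<close>
  have "homeomorphic_maps (topol A) (topol int_group) \<alpha> \<iota>"
    using A by (auto simp: homeomorphic_maps_def continuous_hom_def tsA)
  then have p1: "proper_map (topol A) (topol int_group) \<alpha>"
    by (blast intro: homeomorphic_imp_proper_map homeomorphic_maps_imp_map)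
  have "homeomorphic_maps (topol affine_group) (topol M) \<phi> \<mu>"
    using M by (auto simp: homeomorphic_maps_def continuous_hom_def tsM)
  then have p2: "proper_map (topol affine_group) (topol M) \<phi>"
    by (blast intro: homeomorphic_imp_proper_map homeomorphic_maps_imp_map)
  have "proper_map (topol int_group) (topol affine_group) j"
    using proper_map_int_affine by (simp add: j_def[abs_def])
  then have proper: "proper_map (topol A) (topol M) f"
    unfolding f_def using p1 p2 by (metis proper_map_compose)
  have complete: "c_complete M N g"
    unfolding c_complete_def
  proof (intro allI impI)
    fix K :: "((nat \<Rightarrow> nat) set set \<times> (nat \<Rightarrow> nat)) tgroup" and h k
    assume F: "Hausdorff_factorization M N g K h k"
    then have k: "k x \<in> range \<nu>" if "x \<in> carrier K" for x
      using that N(2) by (auto simp: Hausdorff_factorization_def continuous_hom_def hom_def)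
    \<comment> \<open>With \<open>K\<close> unchanged, the factorization of \<open>g\<close> becomes
      one of \<open>snd\<close>. The fibres stay the same because \<open>\<rho>\<close> is injective
      on the range of \<open>\<nu>\<close>.\<close>
    have F': "Hausdorff_factorization affine_group real_group snd K (h \<circ> \<phi>) (\<rho> \<circ> k)"
      unfolding Hausdorff_factorization_def
    proof (intro conjI)
      have "k x = k y" if "x \<in> carrier K" "y \<in> carrier K" "\<rho> (k x) = \<rho> (k y)" for x y
        using k[OF that(1)] k[OF that(2)] that(3) N(3) by auto
      moreover have "fibrewise_Hausdorff K k"
        using F by (simp add: Hausdorff_factorization_def)
      ultimately show "fibrewise_Hausdorff K (\<rho> \<circ> k)"
        unfolding fibrewise_Hausdorff_def o_apply by blast
      show "\<forall>x\<in>carrier affine_group. snd x = (\<rho> \<circ> k) ((h \<circ> \<phi>) x)"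
      proof
        fix x :: "real \<times> real"
        have "\<nu> (snd x) = k (h (\<phi> x))"
          using F M(2,3) by (cases x) (auto simp: Hausdorff_factorization_def g_def)
        then show "snd x = (\<rho> \<circ> k) ((h \<circ> \<phi>) x)" by (metis N(3) comp_apply)
      qed
    qed (use F M N in \<open>auto simp: Hausdorff_factorization_def intro: continuous_hom_compose\<close>)
    show "c_closed M K h"
      unfolding c_closed_def
    proof (intro allI impI, elim conjE)
      fix B assume B: "subgroup B M" "closedin (topol M) B"
      let ?B = "{x. \<phi> x \<in> B}"
      interpret \<phi>: group_hom affine_group M \<phi>
        using M group_affine by (simp add: group_hom_def group_hom_axioms_def continuous_hom_def topological_group_def)
      have "subgroup ?B affine_group"
      proof (rule group.subgroupI[OF group_affine])
        show "?B \<noteq> {}" using B(1) \<phi>.hom_one by (metis empty_iff mem_Collect_eq subgroup.one_closed)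
      next
        fix x assume "x \<in> ?B"
        then show "inv\<^bsub>affine_group\<^esub> x \<in> ?B"
          using B(1) \<phi>.hom_inv[of x] by (simp add: subgroup.m_inv_closed del: inv_affine)
      next
        fix x y assume "x \<in> ?B" "y \<in> ?B"
        then show "x \<otimes>\<^bsub>affine_group\<^esub> y \<in> ?B"
          using B(1) \<phi>.hom_mult[of x y] by (simp add: subgroup.m_closed)
      qed auto
      moreover have "closedin (topol affine_group) ?B"
        using closedin_continuous_map_preimage[OF _ B(2), of euclidean \<phi>] M(4)
        by (simp add: continuous_hom_def)
      ultimately have "closedin (topol K) ((h \<circ> \<phi>) ` ?B)"
        using c_closed_affine_factor[OF F'] unfolding c_closed_def by blast
      moreover have "\<phi> ` ?B = B" using subgroup.subset[OF B(1)] M(2) by auto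
      ultimately show "closedin (topol K) (h ` B)" by (metis image_comp)
    qed
  qed
  have "\<not> h_complete A N (g \<circ> f)"
  proof
    assume hc: "h_complete A N (g \<circ> f)"
    obtain \<theta> :: real where \<theta>: "\<theta> \<notin> \<rat>"
      using countable_rat uncountable_UNIV_real by (metis UNIV_eq_I)
    have gN: "group N" and gA: "group A" using N A by (auto simp: topological_group_def)
    have \<nu>0: "\<nu> 0 = \<one>\<^bsub>N\<^esub>"
      using N(4) hom_one[of \<nu> real_group N] gN topological_group_real
      by (simp add: continuous_hom_def topological_group_def)
    \<comment> \<open>The composite is trivial, so a constant map can be the second factor; its
      fibre is the whole circle, which is Hausdorff.\<close>
    have "Hausdorff_factorization A N (g \<circ> f) circle_group (rotation \<theta> \<circ> \<alpha>) (\<lambda>_. \<one>\<^bsub>N\<^esub>)"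
      unfolding Hausdorff_factorization_def
    proof (intro conjI)
      show "continuous_hom A circle_group (rotation \<theta> \<circ> \<alpha>)"
        by (rule continuous_hom_compose[OF A(5) continuous_hom_rotation])
      show "continuous_hom circle_group N (\<lambda>_. \<one>\<^bsub>N\<^esub>)"
        using N gN by (auto simp: continuous_hom_def hom_def topological_group_def group.is_monoid)
      have "Hausdorff_space (topol circle_group)"
        by (simp add: Hausdorff_space_subtopology)
      then show "fibrewise_Hausdorff circle_group (\<lambda>_. \<one>\<^bsub>N\<^esub>)"
        unfolding Hausdorff_space_def fibrewise_Hausdorff_def by auto
      show "\<forall>x\<in>carrier A. (g \<circ> f) x = \<one>\<^bsub>N\<^esub>"
        by (auto simp: g_def f_def M j_def \<nu>0)
    qed (rule topological_group_circle)
    \<comment> \<open>The circle is not over the type fixed in the definition of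
      \<open>h_complete\<close>, so the form for arbitrary types is used.\<close>
    from h_complete_universal[OF A(1) hc this]
    have "closedin (topol circle_group) ((rotation \<theta> \<circ> \<alpha>) ` range \<iota>)" by (simp add: A(2))
    moreover have "(rotation \<theta> \<circ> \<alpha>) ` range \<iota> = range (rotation \<theta>)"
      by (auto simp: A(3) image_iff)
    ultimately show False using not_closed_range_rotation[OF \<theta>] by simp
  qed
  with A(1) M(1) N(1) f g proper complete show ?thesis by blast
qed

end
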